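(* Let $k=2$ and use the total order index set $I=\{(v,w)\in\mathbb{N}_0^2: v+w\le 2\}$ (6 modes). For real $q_0,q_1,q_2$ let $\tilde{\mathbf Q}$ be the symmetric $6\times 6$ real matrix indexed by $I$ whose only nonzero entries, up to the symmetry $\tilde Q_{a,b}=\tilde Q_{b,a}$, are $$\tilde Q_{(0,2),(0,2)}=\tilde Q_{(2,0),(2,0)}=q_0,\qquad \tilde Q_{(1,1),(1,1)}=q_1,\qquad \tilde Q_{(0,2),(2,0)}=q_2 .$$ Then $\tilde{\mathbf Q}\tilde{\mathbf D}_x=-(\tilde{\mathbf Q}\tilde{\mathbf D}_x)^T$, $\tilde{\mathbf Q}\tilde{\mathbf D}_y=-(\tilde{\mathbf Q}\tilde{\mathbf D}_y)^T$, and $\tilde{\mathbf T}\tilde{\mathbf Q}=\tilde{\mathbf Q}\tilde{\mathbf T}$ for every rotation $\tilde{\mathbf T}$ of the reference square by a multiple of $\pi/2$. Moreover $\tilde{\mathbf M}+\tilde{\mathbf Q}$ is positive definite if and only if $$q_1>-\tfrac49,\qquad q_0>-\tfrac45,\qquad (5q_0+4)^2-25q_2^2>0 .$$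
   Context: The reference element is $\hat K=[-1,1]^2$, and $\psi_n$ is the Legendre polynomial of degree $n$ normalised by $\psi_n(1)=1$. For a finite index set $I\subset\mathbb{N}_0^2$, the approximation space is spanned by the modes $\phi_{(v,w)}(x,y)=\psi_v(x)\psi_w(y)$, $(v,w)\in I$. Vectors and matrices are indexed by $I$, and a vector of coefficients $\tilde{\mathbf u}$ represents $\sum_{a\in I}\tilde u_a\phi_a$. The modal mass matrix is $\tilde M_{a,b}=\int_{\hat K}\phi_a\phi_b\,\mathrm{d}x\,\mathrm{d}y$. The matrices $\tilde{\mathbf D}_x,\tilde{\mathbf D}_y$ represent $\partial/\partial x,\partial/\partial y$ on coefficient vectors (the space is closed under both). The rotation matrices $\tilde{\mathbf T}$ represent, on coefficient vectors, the maps $p(x,y)\mapsto p(R(x,y))$ with $R$ the rotation by $\pi/2$, $\pi$ or $3\pi/2$ about the origin (the space is invariant under these). *)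

theory Defs
  imports "HOL-Analysis.Analysis" "HOL-Computational_Algebra.Polynomial"
begin

subsection \<open>Legendre polynomials\<close>

text \<open>Rodrigues' formula. The lemmas below show that this is the sequence of orthogonal
  polynomials on \<open>[-1, 1]\<close> with \<open>degree (legendre n) = n\<close> and value \<open>1\<close> at \<open>1\<close>.\<close>

definition legendre :: "nat \<Rightarrow> real poly" where
  "legendre n = smult (1 / (2 ^ n * fact n)) ((pderiv ^^ n) ([:-1, 0, 1:] ^ n))"

lemma poly_pderiv_funpow_root:
  fixes g :: "real poly"
  shows "poly ((pderiv ^^ n) ([:-a, 1:] ^ n * g)) a = fact n * poly g a"
proof (induction n arbitrary: g)
  case (Suc n)
  have "pderiv ([:-a, 1:] ^ Suc n * g)
      = [:-a, 1:] ^ n * (smult (of_nat (Suc n)) g + [:-a, 1:] * pderiv g)"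
    by (simp only: pderiv_mult pderiv_power_Suc) (simp add: pderiv_pCons algebra_simps)
  then have "(pderiv ^^ Suc n) ([:-a, 1:] ^ Suc n * g)
      = (pderiv ^^ n) ([:-a, 1:] ^ n * (smult (of_nat (Suc n)) g + [:-a, 1:] * pderiv g))"
    by (simp only: funpow_Suc_right comp_def)
  then have "poly ((pderiv ^^ Suc n) ([:-a, 1:] ^ Suc n * g)) a
      = fact n * poly (smult (of_nat (Suc n)) g + [:-a, 1:] * pderiv g) a"
    by (simp only: Suc.IH)
  then show ?case
    by (simp add: algebra_simps)
qed simp

lemma poly_pderiv_funpow_root_less:
  fixes g :: "real poly"
  assumes "j < n"
  shows "poly ((pderiv ^^ j) ([:-a, 1:] ^ n * g)) a = 0"
proof -
  from assms obtain m where "n = j + Suc m"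
    using less_imp_Suc_add by fastforce
  then have "[:-a, 1:] ^ n * g = [:-a, 1:] ^ j * ([:-a, 1:] ^ Suc m * g)"
    by (simp only: power_add mult.assoc)
  then show ?thesis
    by (simp only: poly_pderiv_funpow_root) simp
qed

lemma rodrigues_factor: "[:-1, 0, 1 :: real:] ^ n = [:-1, 1:] ^ n * [:1, 1:] ^ n"
  by (simp flip: power_mult_distrib)

lemma poly_legendre_1: "poly (legendre n) 1 = 1"
  using poly_pderiv_funpow_root[of n 1 "[:1, 1:] ^ n"]
  by (simp add: legendre_def rodrigues_factor)

lemma degree_pderiv_funpow: "degree ((pderiv ^^ m) p) = degree p - m" for p :: "real poly"
  by (induction m) (simp_all add: degree_pderiv)

lemma degree_legendre: "degree (legendre n) = n"
  by (simp add: legendre_def degree_pderiv_funpow degree_power_eq)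

lemma poly_integral_by_parts:
  fixes p q :: "real poly"
  assumes "poly p 1 = 0" "poly p (-1) = 0"
  shows "integral {-1..1} (\<lambda>x. poly (pderiv p) x * poly q x)
    = - integral {-1..1} (\<lambda>x. poly p x * poly (pderiv q) x)"
proof -
  have int: "(\<lambda>x. poly r x) integrable_on {-1..1}" for r :: "real poly"
    by (intro integrable_continuous_interval continuous_intros)
  have "((\<lambda>x. poly (pderiv (p * q)) x) has_integral poly (p * q) 1 - poly (p * q) (-1)) {-1..1}"
    by (intro fundamental_theorem_of_calculus,
        simp_all only: DERIV_subset[OF poly_DERIV subset_UNIV]
          flip: has_real_derivative_iff_has_vector_derivative)
  then have "integral {-1..1} (\<lambda>x. poly (pderiv p * q) x + poly (p * pderiv q) x) = 0"
    using assms by (simp add: pderiv_mult has_integral_integrable_integral algebra_simps)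
  then show ?thesis
    using integral_add[OF int[of "pderiv p * q"] int[of "p * pderiv q"]] by simp
qed

lemma legendre_orthogonal:
  assumes "degree q < n"
  shows "integral {-1..1} (\<lambda>x. poly (legendre n) x * poly q x) = 0"
proof -
  define U :: "real poly" where "U = [:-1, 0, 1:] ^ n"
  have van: "poly ((pderiv ^^ j) U) 1 = 0" "poly ((pderiv ^^ j) U) (-1) = 0" if "j < n" for j
    using poly_pderiv_funpow_root_less[OF that, of 1 "[:1, 1:] ^ n"]
      poly_pderiv_funpow_root_less[OF that, of "-1" "[:-1, 1:] ^ n"]
    by (simp_all add: U_def rodrigues_factor mult.commute)
  have "integral {-1..1} (\<lambda>x. poly ((pderiv ^^ m) U) x * poly q x) = 0"
    if "m \<le> n" "degree q < m" for m q
    using that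
  proof (induction m arbitrary: q)
    case (Suc m)
    have *: "integral {-1..1} (\<lambda>x. poly ((pderiv ^^ Suc m) U) x * poly q x)
      = - integral {-1..1} (\<lambda>x. poly ((pderiv ^^ m) U) x * poly (pderiv q) x)"
      using poly_integral_by_parts[of "(pderiv ^^ m) U" q] van[of m] Suc.prems by simp
    show ?case
    proof (cases "degree q = 0")
      case True
      then have "pderiv q = 0" by (simp add: pderiv_eq_0_iff)
      then show ?thesis using * by simp
    next
      case False
      then have "degree (pderiv q) < m" using Suc.prems by (simp add: degree_pderiv)
      then show ?thesis using * Suc.IH[of "pderiv q"] Suc.prems by simp
    qed
  qed simp
  from this[of n q] assms show ?thesis
    by (simp add: legendre_def U_def)
qed

subsection \<open>The modal space\<close>

typedef mode = "{(v :: nat, w :: nat). v + w \<le> 2}"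
  morphisms mode_exps Mode
  by (rule exI[of _ "(0, 0)"]) simp

lemma UNIV_mode: "(UNIV :: mode set) = Mode ` {(0,0), (0,1), (0,2), (1,0), (1,1), (2,0)}"
proof -
  have "{(v :: nat, w :: nat). v + w \<le> 2} = {(0,0), (0,1), (0,2), (1,0), (1,1), (2,0)}"
    by auto
  then show ?thesis
    using type_definition.Abs_image[OF type_definition_mode] by simp
qed

instance mode :: finite
  by standard (simp add: UNIV_mode)

lemma CARD_mode: "CARD(mode) = 6"
  by (simp add: UNIV_mode Mode_inject)

definition ref_square :: "(real \<times> real) set" where
  "ref_square = {-1..1} \<times> {-1..1}"

definition basis_fun :: "mode \<Rightarrow> real \<times> real \<Rightarrow> real" where
  "basis_fun a = (\<lambda>(x, y). poly (legendre (fst (mode_exps a))) x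
                         * poly (legendre (snd (mode_exps a))) y)"

definition modal_fun :: "real ^ mode \<Rightarrow> real \<times> real \<Rightarrow> real" where
  "modal_fun u = (\<lambda>z. \<Sum>a\<in>UNIV. u $ a * basis_fun a z)"

definition mass_matrix :: "real ^ mode ^ mode" where
  "mass_matrix = (\<chi> a b. integral ref_square (\<lambda>z. basis_fun a z * basis_fun b z))"

definition represents ::
  "real ^ mode ^ mode \<Rightarrow> ((real \<times> real \<Rightarrow> real) \<Rightarrow> real \<times> real \<Rightarrow> real) \<Rightarrow> bool" where
  "represents A L \<longleftrightarrow> (\<forall>u. modal_fun (A *v u) = L (modal_fun u))"

definition matrix_of :: "((real \<times> real \<Rightarrow> real) \<Rightarrow> real \<times> real \<Rightarrow> real) \<Rightarrow> real ^ mode ^ mode" where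
  "matrix_of L = (THE A. represents A L)"

definition partial_x :: "(real \<times> real \<Rightarrow> real) \<Rightarrow> real \<times> real \<Rightarrow> real" where
  "partial_x p = (\<lambda>(x, y). deriv (\<lambda>s. p (s, y)) x)"

definition partial_y :: "(real \<times> real \<Rightarrow> real) \<Rightarrow> real \<times> real \<Rightarrow> real" where
  "partial_y p = (\<lambda>(x, y). deriv (\<lambda>t. p (x, t)) y)"

definition rotation :: "real \<Rightarrow> real \<times> real \<Rightarrow> real \<times> real" where
  "rotation \<theta> = (\<lambda>(x, y). (cos \<theta> * x - sin \<theta> * y, sin \<theta> * x + cos \<theta> * y))"

definition D_x :: "real ^ mode ^ mode" where
  "D_x = matrix_of partial_x"

definition D_y :: "real ^ mode ^ mode" where
  "D_y = matrix_of partial_y"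

definition rot_matrix :: "int \<Rightarrow> real ^ mode ^ mode" where
  "rot_matrix j = matrix_of (\<lambda>p. p \<circ> rotation (of_int j * pi / 2))"

text \<open>The three operators do have representing matrices, and these are unique, so the
  definite descriptions above denote.\<close>

lemma legendre_simps:
  "legendre 0 = 1" "legendre (Suc 0) = [:0, 1:]" "legendre 2 = [:-1/2, 0, 3/2:]"
  by (simp_all add: legendre_def numeral_2_eq_2 pderiv_pCons one_pCons)

lemma sum_mode:
  "(\<Sum>a\<in>UNIV. f a) = f (Mode (0,0)) + f (Mode (0,1)) + f (Mode (0,2))
     + f (Mode (1,0)) + f (Mode (1,1)) + (f (Mode (2,0)) :: real)"
  by (simp add: UNIV_mode Mode_inject)

lemma all_mode:
  "(\<forall>a. P a) \<longleftrightarrow> P (Mode (0,0)) \<and> P (Mode (0,1)) \<and> P (Mode (0,2))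
     \<and> P (Mode (1,0)) \<and> P (Mode (1,1)) \<and> P (Mode (2,0))"
proof -
  have "(\<forall>a. P a) \<longleftrightarrow> (\<forall>a\<in>UNIV. P a)" by simp
  then show ?thesis unfolding UNIV_mode by simp
qed

lemma modal_fun_eq:
  "modal_fun u (x, y) = u $ Mode (0,0) + u $ Mode (0,1) * y + u $ Mode (0,2) * ((3 * y\<^sup>2 - 1) / 2)
     + u $ Mode (1,0) * x + u $ Mode (1,1) * (x * y) + u $ Mode (2,0) * ((3 * x\<^sup>2 - 1) / 2)"
  by (simp add: modal_fun_def sum_mode basis_fun_def Mode_inverse legendre_simps
      field_simps power2_eq_square)

lemma inj_modal_fun: "inj modal_fun"
proof (rule injI)
  fix u v assume "modal_fun u = modal_fun v"
  then have h: "modal_fun u (x, y) = modal_fun v (x, y)" for x y by simp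
  show "u = v"
    using h[of 0 0] h[of 1 0] h[of "-1" 0] h[of 0 1] h[of 0 "-1"] h[of 1 1]
    by (simp add: vec_eq_iff all_mode modal_fun_eq)
qed

lemma matrix_of_eq:
  assumes "represents A L"
  shows "matrix_of L = A"
  unfolding matrix_of_def
proof (rule the_equality)
  fix B assume "represents B L"
  with assms have "modal_fun (B *v u) = modal_fun (A *v u)" for u
    by (simp add: represents_def)
  then have "B *v u = A *v u" for u using inj_modal_fun by (blast dest: injD)
  then show "B = A" by (simp add: matrix_eq)
qed fact

lemma represents_D_x: "represents D_x partial_x"
proof -
  let ?A = "(\<chi> a b. if a = Mode (0,0) \<and> b = Mode (1,0) then 1
    else if a = Mode (0,1) \<and> b = Mode (1,1) then 1
    else if a = Mode (1,0) \<and> b = Mode (2,0) then 3 else 0) :: real ^ mode ^ mode"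
  have "modal_fun (?A *v u) (x, y) = partial_x (modal_fun u) (x, y)" for u x y
  proof -
    have "((\<lambda>s. modal_fun u (s, y)) has_real_derivative modal_fun (?A *v u) (x, y)) (at x)"
      unfolding modal_fun_eq
      by (auto intro!: derivative_eq_intros simp: matrix_vector_mult_def sum_mode Mode_inject)
    then show ?thesis by (simp add: partial_x_def DERIV_imp_deriv)
  qed
  then have "represents ?A partial_x" by (auto simp: represents_def fun_eq_iff)
  then show ?thesis by (simp only: D_x_def matrix_of_eq)
qed

lemma represents_D_y: "represents D_y partial_y"
proof -
  let ?A = "(\<chi> a b. if a = Mode (0,0) \<and> b = Mode (0,1) then 1
    else if a = Mode (1,0) \<and> b = Mode (1,1) then 1
    else if a = Mode (0,1) \<and> b = Mode (0,2) then 3 else 0) :: real ^ mode ^ mode"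
  have "modal_fun (?A *v u) (x, y) = partial_y (modal_fun u) (x, y)" for u x y
  proof -
    have "((\<lambda>t. modal_fun u (x, t)) has_real_derivative modal_fun (?A *v u) (x, y)) (at y)"
      unfolding modal_fun_eq
      by (auto intro!: derivative_eq_intros simp: matrix_vector_mult_def sum_mode Mode_inject)
    then show ?thesis by (simp add: partial_y_def DERIV_imp_deriv)
  qed
  then have "represents ?A partial_y" by (auto simp: represents_def fun_eq_iff)
  then show ?thesis by (simp only: D_y_def matrix_of_eq)
qed

lemma represents_rot_matrix: "represents (rot_matrix j) (\<lambda>p. p \<circ> rotation (of_int j * pi / 2))"
proof -
  define t where "t = of_int j * pi / 2"
  let ?c = "cos t" and ?s = "sin t"
  have "sin (2 * t) = 0" by (simp add: t_def sin_zero_iff_int2)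
  then have "?s = 0 \<or> ?c = 0" by (simp add: sin_double)
  then consider "?s = 0" "?c\<^sup>2 = 1" | "?c = 0" "?s\<^sup>2 = 1"
    using sin_cos_squared_add[of t] by (metis add.right_neutral add.left_neutral zero_power2)
  note cases = this
  let ?A = "(\<chi> a b. if a = Mode (0,0) \<and> b = Mode (0,0) then 1
    else if a = Mode (0,1) \<and> b = Mode (0,1) then ?c
    else if a = Mode (1,0) \<and> b = Mode (0,1) then ?s
    else if a = Mode (1,0) \<and> b = Mode (1,0) then ?c
    else if a = Mode (0,1) \<and> b = Mode (1,0) then - ?s
    else if a = Mode (1,1) \<and> b = Mode (1,1) then ?c\<^sup>2 - ?s\<^sup>2
    else if a = Mode (0,2) \<and> b = Mode (0,2) \<or> a = Mode (2,0) \<and> b = Mode (2,0) then ?c\<^sup>2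
    else if a = Mode (0,2) \<and> b = Mode (2,0) \<or> a = Mode (2,0) \<and> b = Mode (0,2) then ?s\<^sup>2
    else 0) :: real ^ mode ^ mode"
  have "modal_fun (?A *v u) (x, y) = modal_fun u (rotation t (x, y))" for u x y
    using cases
    unfolding rotation_def split modal_fun_eq
    by cases (simp_all add: matrix_vector_mult_def sum_mode Mode_inject power_mult_distrib,
        simp_all add: power2_eq_square algebra_simps)
  then have "represents ?A (\<lambda>p. p \<circ> rotation t)" by (auto simp: represents_def fun_eq_iff)
  then show ?thesis by (simp only: rot_matrix_def matrix_of_eq flip: t_def)
qed

text \<open>Comparing unordered pairs of indices builds in the symmetry of the matrix.\<close>

definition Q_matrix :: "real \<Rightarrow> real \<Rightarrow> real \<Rightarrow> real ^ mode ^ mode" where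
  "Q_matrix q0 q1 q2 = (\<chi> a b.
     let s = {mode_exps a, mode_exps b} in
     if s = {(0, 2)} \<or> s = {(2, 0)} then q0
     else if s = {(1, 1)} then q1
     else if s = {(0, 2), (2, 0)} then q2
     else 0)"

definition positive_definite :: "real ^ 'n ^ 'n \<Rightarrow> bool" where
  "positive_definite A \<longleftrightarrow> transpose A = A \<and> (\<forall>v. v \<noteq> 0 \<longrightarrow> v \<bullet> (A *v v) > 0)"

end

theory Submission
  imports Defs
begin

text \<open>Every nonzero row and column of \<open>Q\<close> belongs to a mode of total degree \<open>2\<close>. Differentiation
  lands in degree at most \<open>1\<close>, so \<open>Q D\<^sub>x\<close> and \<open>Q D\<^sub>y\<close> vanish. A quarter turn exchanges the modes
  \<open>(0,2)\<close> and \<open>(2,0)\<close> and negates \<open>(1,1)\<close>, which \<open>Q\<close> respects. The mass matrix is diagonal by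
  orthogonality, so definiteness of \<open>M + Q\<close> is decided by the entry at \<open>(1,1)\<close> and the
  \<open>2 \<times> 2\<close> block at \<open>(0,2), (2,0)\<close>.\<close>

section \<open>Action of \<open>Q_matrix\<close> and its products with the derivative
  matrices\<close>

lemma Q_matrix_mult:
  "(Q_matrix q0 q1 q2 *v u) $ Mode (0,0) = 0"
  "(Q_matrix q0 q1 q2 *v u) $ Mode (0,1) = 0"
  "(Q_matrix q0 q1 q2 *v u) $ Mode (1,0) = 0"
  "(Q_matrix q0 q1 q2 *v u) $ Mode (1,1) = q1 * u $ Mode (1,1)"
  "(Q_matrix q0 q1 q2 *v u) $ Mode (0,2) = q0 * u $ Mode (0,2) + q2 * u $ Mode (2,0)"
  "(Q_matrix q0 q1 q2 *v u) $ Mode (2,0) = q2 * u $ Mode (0,2) + q0 * u $ Mode (2,0)"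
  by (simp_all add: matrix_vector_mult_def sum_mode Q_matrix_def Mode_inverse doubleton_eq_iff)

lemma transpose_Q_matrix: "transpose (Q_matrix q0 q1 q2) = Q_matrix q0 q1 q2"
  by (simp add: vec_eq_iff transpose_def Q_matrix_def insert_commute conj_commute)

text \<open>Difference stencils on the grid with coordinates in {-1, 0, 1}. They recover the
  components of \<open>D_x *v u\<close> or \<open>rot_matrix j *v u\<close> from the represented
  function alone, so no explicit matrix is needed.\<close>

lemma modal_coeff:
  "u $ Mode (0,0) = (modal_fun u (1,0) + modal_fun u (-1,0)
     + modal_fun u (0,1) + modal_fun u (0,-1) + 2 * modal_fun u (0,0)) / 6"
  "u $ Mode (0,1) = (modal_fun u (0,1) - modal_fun u (0,-1)) / 2"
  "u $ Mode (1,0) = (modal_fun u (1,0) - modal_fun u (-1,0)) / 2"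
  "u $ Mode (1,1) = (modal_fun u (1,1) - modal_fun u (1,-1)
     - modal_fun u (-1,1) + modal_fun u (-1,-1)) / 4"
  "u $ Mode (0,2) = (modal_fun u (0,1) + modal_fun u (0,-1) - 2 * modal_fun u (0,0)) / 3"
  "u $ Mode (2,0) = (modal_fun u (1,0) + modal_fun u (-1,0) - 2 * modal_fun u (0,0)) / 3"
  by (simp_all add: modal_fun_eq)

lemma partial_x_modal_fun:
  "partial_x (modal_fun u) (x, y) = u $ Mode (1,0) + u $ Mode (1,1) * y + 3 * u $ Mode (2,0) * x"
proof -
  have "((\<lambda>s. modal_fun u (s, y)) has_real_derivative
      u $ Mode (1,0) + u $ Mode (1,1) * y + 3 * u $ Mode (2,0) * x) (at x)"
    unfolding modal_fun_eq by (auto intro!: derivative_eq_intros)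
  then show ?thesis by (simp add: partial_x_def DERIV_imp_deriv)
qed

lemma partial_y_modal_fun:
  "partial_y (modal_fun u) (x, y) = u $ Mode (0,1) + u $ Mode (1,1) * x + 3 * u $ Mode (0,2) * y"
proof -
  have "((\<lambda>t. modal_fun u (x, t)) has_real_derivative
      u $ Mode (0,1) + u $ Mode (1,1) * x + 3 * u $ Mode (0,2) * y) (at y)"
    unfolding modal_fun_eq by (auto intro!: derivative_eq_intros)
  then show ?thesis by (simp add: partial_y_def DERIV_imp_deriv)
qed

text \<open>The derivative of a represented function is affine, and \<open>modal_coeff(4-6)\<close>
  are second differences, which vanish on affine functions. These are the only components that
  \<open>Q_matrix\<close> sees.\<close>

lemma Q_matrix_D_x: "Q_matrix q0 q1 q2 ** D_x = 0"
proof -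
  have m: "modal_fun (D_x *v u) = partial_x (modal_fun u)" for u
    using represents_D_x by (simp add: represents_def)
  have "Q_matrix q0 q1 q2 *v (D_x *v u) = 0" for u
    by (simp add: vec_eq_iff all_mode Q_matrix_mult modal_coeff(4-6)[of "D_x *v u"] m
        partial_x_modal_fun del: One_nat_def)
  then show ?thesis
    by (simp add: matrix_eq flip: matrix_vector_mul_assoc)
qed

lemma Q_matrix_D_y: "Q_matrix q0 q1 q2 ** D_y = 0"
proof -
  have m: "modal_fun (D_y *v u) = partial_y (modal_fun u)" for u
    using represents_D_y by (simp add: represents_def)
  have "Q_matrix q0 q1 q2 *v (D_y *v u) = 0" for u
    by (simp add: vec_eq_iff all_mode Q_matrix_mult modal_coeff(4-6)[of "D_y *v u"] m
        partial_y_modal_fun del: One_nat_def)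
  then show ?thesis
    by (simp add: matrix_eq flip: matrix_vector_mul_assoc)
qed

section \<open>Commutation with rotations\<close>

lemma rot_matrix_commutes_Q_matrix:
  "rot_matrix j ** Q_matrix q0 q1 q2 = Q_matrix q0 q1 q2 ** rot_matrix j"
proof -
  define t where "t = of_int j * pi / 2"
  \<comment> \<open>Since \<open>2 * t\<close> is an integer multiple of \<open>pi\<close>, two
    cases cover every \<open>j\<close>; the sign of the surviving function never has to be
    fixed.\<close>
  have "sin (2 * t) = 0" by (simp add: t_def sin_zero_iff_int2)
  then have "sin t = 0 \<or> cos t = 0" by (simp add: sin_double)
  then consider "sin t = 0" "(cos t)\<^sup>2 = 1" | "cos t = 0" "(sin t)\<^sup>2 = 1"
    using sin_cos_squared_add[of t] by (metis add.right_neutral add.left_neutral zero_power2)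
  note quarter_turn = this
  have m: "modal_fun (rot_matrix j *v u) (x, y)
      = modal_fun u (cos t * x - sin t * y, sin t * x + cos t * y)" for u x y
    using represents_rot_matrix[of j] by (simp add: represents_def rotation_def flip: t_def)
  \<comment> \<open>Special to quarter turns: a general rotation also couples
    \<open>Mode (1,1)\<close> with \<open>Mode (0,2)\<close> and \<open>Mode (2,0)\<close>, by
    multiples of \<open>sin t * cos t\<close>, which is 0 here.\<close>
  have coeff: "(rot_matrix j *v u) $ Mode (0,0) = u $ Mode (0,0)"
    "(rot_matrix j *v u) $ Mode (0,1) = cos t * u $ Mode (0,1) - sin t * u $ Mode (1,0)"
    "(rot_matrix j *v u) $ Mode (1,0) = sin t * u $ Mode (0,1) + cos t * u $ Mode (1,0)"
    "(rot_matrix j *v u) $ Mode (1,1) = ((cos t)\<^sup>2 - (sin t)\<^sup>2) * u $ Mode (1,1)"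
    "(rot_matrix j *v u) $ Mode (0,2) = (cos t)\<^sup>2 * u $ Mode (0,2) + (sin t)\<^sup>2 * u $ Mode (2,0)"
    "(rot_matrix j *v u) $ Mode (2,0) = (sin t)\<^sup>2 * u $ Mode (0,2) + (cos t)\<^sup>2 * u $ Mode (2,0)"
    for u
    using quarter_turn
    unfolding modal_coeff[of "rot_matrix j *v u"] m modal_fun_eq[of u]
    by (cases; simp add: power_mult_distrib power2_diff power2_sum;
        simp add: power2_eq_square algebra_simps)+
  have "rot_matrix j *v (Q_matrix q0 q1 q2 *v u) = Q_matrix q0 q1 q2 *v (rot_matrix j *v u)" for u
    using quarter_turn
    by cases (simp_all add: vec_eq_iff all_mode Q_matrix_mult coeff algebra_simps
        del: One_nat_def)
  then show ?thesis
    by (simp add: matrix_eq flip: matrix_vector_mul_assoc)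
qed

section \<open>Entries of the mass matrix\<close>

lemma integral_pderiv:
  fixes P :: "real poly"
  shows "integral {-1..1} (\<lambda>x. poly (pderiv P) x) = poly P 1 - poly P (-1)"
  by (intro integral_unique fundamental_theorem_of_calculus,
      simp_all only: DERIV_subset[OF poly_DERIV subset_UNIV]
        flip: has_real_derivative_iff_has_vector_derivative)

lemma legendre_norm:
  assumes "n \<le> 2"
  shows "integral {-1..1} (\<lambda>x. poly (legendre n) x * poly (legendre n) x) = 2 / (2 * real n + 1)"
proof -
  have "n = 0 \<or> n = Suc 0 \<or> n = 2" using assms by auto
  then show ?thesis
    \<comment> \<open>Antiderivatives of the squares 1, \<open>x^2\<close> and
      \<open>(9 x^4 - 6 x^2 + 1) / 4\<close> of the first three Legendre polynomials.\<close>
    using integral_pderiv[of "[:0, 1:]"] integral_pderiv[of "[:0, 0, 0, 1/3:]"]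
      integral_pderiv[of "[:0, 1/4, 0, -1/2, 0, 9/20:]"]
    by (auto simp: legendre_simps pderiv_pCons algebra_simps)
qed

lemma legendre_orthogonal':
  assumes "m \<noteq> n"
  shows "integral {-1..1} (\<lambda>x. poly (legendre m) x * poly (legendre n) x) = 0"
  using assms legendre_orthogonal[of "legendre m" n] legendre_orthogonal[of "legendre n" m]
  by (cases "m < n") (simp_all add: degree_legendre mult.commute)

lemma integral_ref_square_prod:
  fixes f g :: "real \<Rightarrow> real"
  assumes "continuous_on {-1..1} f" "continuous_on {-1..1} g"
  shows "integral ref_square (\<lambda>(x, y). f x * g y) = integral {-1..1} f * integral {-1..1} g"
proof -
  have sq: "ref_square = cbox (-1, -1) (1, 1)"
    by (simp add: ref_square_def cbox_Pair_eq)
  have "continuous_on (cbox (-1, -1) (1, 1)) (\<lambda>(x, y). f x * g y)"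
    unfolding sq[symmetric] ref_square_def split_def
    by (intro continuous_intros continuous_on_compose2[OF assms(1)]
        continuous_on_compose2[OF assms(2)]) auto
  from integral_prod_continuous[OF this] show ?thesis
    by (simp add: sq)
qed

lemma mass_matrix_entry:
  "mass_matrix $ a $ b = (if a = b
     then 2 / (2 * fst (mode_exps a) + 1) * (2 / (2 * snd (mode_exps a) + 1)) else 0)"
proof -
  obtain v w v' w' where exps: "mode_exps a = (v, w)" "mode_exps b = (v', w')" by fastforce
  have le: "v \<le> 2" "w \<le> 2" using mode_exps[of a] exps by auto
  have eq: "a = b \<longleftrightarrow> v = v' \<and> w = w'" using exps by (metis mode_exps_inject prod.inject)
  have "mass_matrix $ a $ b = integral ref_square (\<lambda>(x, y).
      (poly (legendre v) x * poly (legendre v') x) * (poly (legendre w) y * poly (legendre w') y))"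
    by (simp add: mass_matrix_def basis_fun_def exps split_def mult_ac)
  also have "\<dots> = integral {-1..1} (\<lambda>x. poly (legendre v) x * poly (legendre v') x)
      * integral {-1..1} (\<lambda>y. poly (legendre w) y * poly (legendre w') y)"
    by (intro integral_ref_square_prod continuous_intros)
  finally show ?thesis
    using le by (auto simp: eq exps legendre_norm legendre_orthogonal' add.commute)
qed

section \<open>Positive definiteness\<close>

lemma mass_plus_Q_form:
  "v \<bullet> ((mass_matrix + Q_matrix q0 q1 q2) *v v)
    = 4 * (v $ Mode (0,0))\<^sup>2 + 4/3 * (v $ Mode (0,1))\<^sup>2 + 4/3 * (v $ Mode (1,0))\<^sup>2
      + (q1 + 4/9) * (v $ Mode (1,1))\<^sup>2
      + ((q0 + 4/5) * ((v $ Mode (0,2))\<^sup>2 + (v $ Mode (2,0))\<^sup>2)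
         + 2 * q2 * (v $ Mode (0,2) * v $ Mode (2,0)))"
proof -
  \<comment> \<open>The coefficient at mode (v, w) is 4 / ((2v+1)(2w+1)); the values 4/9 and 4/5
    give the thresholds for \<open>q1\<close> and \<open>q0\<close>.\<close>
  have "v \<bullet> (mass_matrix *v v) = 4 * (v $ Mode (0,0))\<^sup>2 + 4/3 * (v $ Mode (0,1))\<^sup>2
      + 4/3 * (v $ Mode (1,0))\<^sup>2 + 4/9 * (v $ Mode (1,1))\<^sup>2
      + 4/5 * (v $ Mode (0,2))\<^sup>2 + 4/5 * (v $ Mode (2,0))\<^sup>2"
    by (simp add: inner_vec_def sum_mode matrix_vector_mult_def mass_matrix_entry Mode_inject
        Mode_inverse power2_eq_square)
  moreover have "v \<bullet> (Q_matrix q0 q1 q2 *v v) = q1 * (v $ Mode (1,1))\<^sup>2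
      + q0 * ((v $ Mode (0,2))\<^sup>2 + (v $ Mode (2,0))\<^sup>2)
      + 2 * q2 * (v $ Mode (0,2) * v $ Mode (2,0))"
    by (simp add: inner_vec_def sum_mode Q_matrix_mult power2_eq_square algebra_simps
        del: One_nat_def)
  ultimately show ?thesis
    by (simp add: matrix_vector_mult_add_rdistrib inner_add_right algebra_simps)
qed

text \<open>The form has eigenvalues p + q and p - q, with eigenvectors (1, 1) and (1, -1). It is
  therefore a positive combination of the squares of x + y and x - y.\<close>

lemma binary_form_pos:
  fixes p q x y :: real
  assumes "0 < p" "q\<^sup>2 < p\<^sup>2" "x \<noteq> 0 \<or> y \<noteq> 0"
  shows "0 < p * (x\<^sup>2 + y\<^sup>2) + 2 * q * (x * y)"
proof -
  have "\<bar>q\<bar> < p" using assms power2_less_imp_less[of "\<bar>q\<bar>" p] by simp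
  then have "0 < (p + q) / 2" "0 < (p - q) / 2" by simp_all
  moreover have "x + y \<noteq> 0 \<or> x - y \<noteq> 0" using assms(3) by auto
  ultimately have "0 < (p + q) / 2 * (x + y)\<^sup>2 + (p - q) / 2 * (x - y)\<^sup>2"
    by (metis add_pos_nonneg add_nonneg_pos mult_pos_pos mult_nonneg_nonneg less_imp_le
        zero_le_power2 zero_less_power2)
  then show ?thesis by (simp add: field_simps power2_eq_square)
qed

lemma mass_plus_Q_positive_definite:
  "positive_definite (mass_matrix + Q_matrix q0 q1 q2)
    \<longleftrightarrow> q1 > - 4/9 \<and> q0 > - 4/5 \<and> (5 * q0 + 4)\<^sup>2 - 25 * q2\<^sup>2 > 0"
    (is "_ \<longleftrightarrow> ?cond")
proof
  assume pd: "positive_definite (mass_matrix + Q_matrix q0 q1 q2)"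
  have pos: "0 < v \<bullet> ((mass_matrix + Q_matrix q0 q1 q2) *v v)" if "v $ a \<noteq> 0" for v a
    using pd that by (metis positive_definite_def zero_index)
  \<comment> \<open>Unit vectors test the diagonal entries; below, the sum and difference of two
    unit vectors are the eigenvectors of the coupled block.\<close>
  have q1: "0 < q1 + 4/9"
    using pos[of "axis (Mode (1,1)) 1" "Mode (1,1)"]
    by (simp add: mass_plus_Q_form) (simp add: axis_def Mode_inject)
  have q0: "0 < q0 + 4/5"
    using pos[of "axis (Mode (0,2)) 1" "Mode (0,2)"]
    by (simp add: mass_plus_Q_form) (simp add: axis_def Mode_inject)
  have sum: "0 < (q0 + 4/5) + q2"
    using pos[of "axis (Mode (0,2)) 1 + axis (Mode (2,0)) 1" "Mode (0,2)"]
    by (simp add: mass_plus_Q_form) (simp add: axis_def Mode_inject)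
  have diff: "0 < (q0 + 4/5) - q2"
    using pos[of "axis (Mode (0,2)) 1 - axis (Mode (2,0)) 1" "Mode (0,2)"]
    by (simp add: mass_plus_Q_form) (simp add: axis_def Mode_inject)
  \<comment> \<open>This is 25 times the determinant of the block, that is, of the product of its
    two eigenvalues.\<close>
  have "(5 * q0 + 4)\<^sup>2 - 25 * q2\<^sup>2 = 25 * ((q0 + 4/5 + q2) * (q0 + 4/5 - q2))"
    by (simp add: field_simps power2_eq_square)
  also have "\<dots> > 0" using sum diff by simp
  finally show ?cond using q0 q1 by simp
next
  assume c: ?cond
  then have q: "0 < q1 + 4/9" "0 < q0 + 4/5" "q2\<^sup>2 < (q0 + 4/5)\<^sup>2"
    by (simp_all add: field_simps power2_eq_square)
  have "0 < v \<bullet> ((mass_matrix + Q_matrix q0 q1 q2) *v v)" if "v \<noteq> 0" for v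
  proof -
    \<comment> \<open>\<open>r\<close> collects the four uncoupled modes and \<open>s\<close> the
      coupled block. If the block components of \<open>v\<close> vanish, then \<open>r\<close> must
      be positive; otherwise \<open>s\<close> is.\<close>
    define r where "r = 4 * (v $ Mode (0,0))\<^sup>2 + 4/3 * (v $ Mode (0,1))\<^sup>2
      + 4/3 * (v $ Mode (1,0))\<^sup>2 + (q1 + 4/9) * (v $ Mode (1,1))\<^sup>2"
    define s where "s = (q0 + 4/5) * ((v $ Mode (0,2))\<^sup>2 + (v $ Mode (2,0))\<^sup>2)
      + 2 * q2 * (v $ Mode (0,2) * v $ Mode (2,0))"
    have "0 \<le> r" unfolding r_def using q(1) by simp
    show ?thesis
    proof (cases "v $ Mode (0,2) = 0 \<and> v $ Mode (2,0) = 0")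
      case True
      then have "v $ Mode (0,0) \<noteq> 0 \<or> v $ Mode (0,1) \<noteq> 0 \<or> v $ Mode (1,0) \<noteq> 0
          \<or> v $ Mode (1,1) \<noteq> 0"
        using \<open>v \<noteq> 0\<close> by (auto simp: vec_eq_iff all_mode)
      then have "r \<noteq> 0"
        unfolding r_def using q(1) by (auto simp: add_nonneg_eq_0_iff)
      with \<open>0 \<le> r\<close> True show ?thesis
        unfolding mass_plus_Q_form r_def by simp
    next
      case False
      then have "0 < s" unfolding s_def by (intro binary_form_pos q) auto
      with \<open>0 \<le> r\<close> show ?thesis
        unfolding mass_plus_Q_form r_def s_def by linarith
    qed
  qed
  moreover have "transpose mass_matrix = mass_matrix"
    by (auto simp: vec_eq_iff transpose_def mass_matrix_entry)
  then have "transpose (mass_matrix + Q_matrix q0 q1 q2) = mass_matrix + Q_matrix q0 q1 q2"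
    using transpose_Q_matrix[of q0 q1 q2] by (simp add: vec_eq_iff transpose_def)
  ultimately show "positive_definite (mass_matrix + Q_matrix q0 q1 q2)"
    by (simp add: positive_definite_def)
qed

theorem mainTheorem4:
  fixes q0 q1 q2 :: real
  shows "Q_matrix q0 q1 q2 ** D_x = - transpose (Q_matrix q0 q1 q2 ** D_x)
    \<and> Q_matrix q0 q1 q2 ** D_y = - transpose (Q_matrix q0 q1 q2 ** D_y)
    \<and> (\<forall>j. rot_matrix j ** Q_matrix q0 q1 q2 = Q_matrix q0 q1 q2 ** rot_matrix j)
    \<and> (positive_definite (mass_matrix + Q_matrix q0 q1 q2)
         \<longleftrightarrow> q1 > - 4 / 9 \<and> q0 > - 4 / 5 \<and> (5 * q0 + 4)\<^sup>2 - 25 * q2\<^sup>2 > 0)"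
proof -
  \<comment> \<open>Both skew-symmetry claims reduce to this identity, because the two products are
    zero.\<close>
  have "- transpose 0 = (0 :: real ^ mode ^ mode)"
    by (simp add: vec_eq_iff transpose_def)
  then show ?thesis
    unfolding Q_matrix_D_x Q_matrix_D_y
    using rot_matrix_commutes_Q_matrix mass_plus_Q_positive_definite by simp
qed

end
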